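(* Let $\mathcal{G}$ be an undirected connected graph on $p$ nodes with (possibly signed) real edge weights, whose Laplacian $L\in\mathbb{R}^{p\times p}$ is positive semidefinite and has rank $p-1$. Let $R$ be the effective resistance matrix of $\mathcal{G}$. Then there exists $\gamma>1$ such that $\mathcal{G}\in\Omega_a$ for all $a\in[1,\gamma]$; that is, for every $a\in[1,\gamma]$ the elementwise power $R^{\circ a}$ is a Euclidean distance matrix.
   Context: Edge weights may be negative. The Laplacian of an undirected weighted graph on nodes $\{1,\dots,p\}$ with symmetric weights $W_{ij}=W_{ji}\in\mathbb{R}$ ($W_{ij}=0$ if there is no edge, $W_{ii}=0$) is the symmetric matrix with $L_{ij}=-W_{ij}$ for $i\neq j$ and $L_{ii}=\sum_j W_{ij}$. $\mathbf{1}\in\mathbb{R}^p$ is the all-ones column vector, $L^\dagger$ is the Moore–Penrose pseudoinverse of $L$, and $\mathrm{diag}(M)$ is the column vector of diagonal entries of $M$. The effective resistance matrix of $\mathcal{G}$ is $R=\mathbf{1}\,\mathrm{diag}(L^\dagger)^\top+\mathrm{diag}(L^\dagger)\mathbf{1}^\top-2L^\dagger$, i.e. $R_{ij}=L^\dagger_{ii}+L^\dagger_{jj}-2L^\dagger_{ij}$. A $p\times p$ matrix $D$ is a Euclidean distance matrix (EDM) if there are points $y_1,\dots,y_p\in\mathbb{R}^d$, for some $0\le d\le p-1$, with $D_{ij}=\|y_i-y_j\|_2^2$ (squared distances) for all $i,j$. For a matrix $D$ with nonnegative entries and $\alpha>0$, the elementwise power $D^{\circ\alpha}$ is the matrix with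 entries $[D^{\circ\alpha}]_{ij}=D_{ij}^{\alpha}$. For a real number $a$, $\Omega_a$ denotes the set of all graphs whose effective resistance matrix $R$ is such that $R^{\circ a}$ is an EDM. *)

theory Defs
  imports "HOL-Analysis.Analysis"
begin

text \<open>A graph on the node set \<open>'n\<close> is given by its weight matrix;
  \<open>W $ i $ j = 0\<close> means that there is no edge between \<open>i\<close> and \<open>j\<close>.\<close>

definition weighted_graph :: "real^'n^'n \<Rightarrow> bool" where
  "weighted_graph W \<longleftrightarrow> (\<forall>i j. W $ i $ j = W $ j $ i) \<and> (\<forall>i. W $ i $ i = 0)"

definition edges :: "real^'n^'n \<Rightarrow> ('n \<times> 'n) set" where
  "edges W = {(i, j). W $ i $ j \<noteq> 0}"

definition graph_connected :: "real^'n^'n \<Rightarrow> bool" where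
  "graph_connected W \<longleftrightarrow> (\<forall>i j. (i, j) \<in> (edges W)\<^sup>*)"

definition laplacian :: "real^'n^'n \<Rightarrow> real^'n^'n" where
  "laplacian W = (\<chi> i j. if i = j then (\<Sum>k\<in>UNIV. W $ i $ k) else - W $ i $ j)"

definition positive_semidefinite :: "real^'n^'n \<Rightarrow> bool" where
  "positive_semidefinite A \<longleftrightarrow> transpose A = A \<and> (\<forall>x. 0 \<le> x \<bullet> (A *v x))"

text \<open>The four Penrose conditions, for real matrices.\<close>

definition is_pseudoinverse :: "real^'n^'m \<Rightarrow> real^'m^'n \<Rightarrow> bool" where
  "is_pseudoinverse A X \<longleftrightarrow>
     A ** X ** A = A \<and> X ** A ** X = X \<and>
     transpose (A ** X) = A ** X \<and> transpose (X ** A) = X ** A"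

lemma is_pseudoinverse_unique:
  assumes X: "is_pseudoinverse A X" and Y: "is_pseudoinverse A Y"
  shows "X = Y"
proof -
  note x = X[unfolded is_pseudoinverse_def]
  note y = Y[unfolded is_pseudoinverse_def]
  have "A ** X = transpose (A ** Y ** (A ** X))"
    using x y by (metis matrix_mul_assoc)
  also have "\<dots> = A ** X ** (A ** Y)"
    using x y by (simp add: matrix_transpose_mul[of "A ** Y" "A ** X"])
  also have "\<dots> = A ** Y"
    using x by (metis matrix_mul_assoc)
  finally have AXY: "A ** X = A ** Y" .
  have "X ** A = transpose (X ** A ** (Y ** A))"
    using x y by (metis matrix_mul_assoc)
  also have "\<dots> = Y ** A ** (X ** A)"
    using x y by (simp add: matrix_transpose_mul[of "X ** A" "Y ** A"])
  also have "\<dots> = Y ** A"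
    using x by (metis matrix_mul_assoc)
  finally have XYA: "X ** A = Y ** A" .
  have "X = X ** A ** X" using x by simp
  also have "\<dots> = Y ** A ** Y" using AXY XYA by (metis matrix_mul_assoc)
  finally show ?thesis using y by simp
qed

definition pseudoinverse :: "real^'n^'m \<Rightarrow> real^'m^'n" where
  "pseudoinverse A = (THE X. is_pseudoinverse A X)"

definition effective_resistance :: "real^'n^'n \<Rightarrow> real^'n^'n" where
  "effective_resistance W =
     (let P = pseudoinverse (laplacian W) in \<chi> i j. P $ i $ i + P $ j $ j - 2 * P $ i $ j)"

text \<open>The dimension \<open>d\<close> of the embedding space is existentially quantified, so
  \<open>\<real>\<^sup>d\<close> is represented by the first \<open>d\<close> coordinates of functions on \<open>nat\<close>.\<close>

definition is_EDM :: "real^'n^'n \<Rightarrow> bool" where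
  "is_EDM D \<longleftrightarrow>
     (\<exists>d \<le> CARD('n) - 1. \<exists>y :: 'n \<Rightarrow> nat \<Rightarrow> real.
        \<forall>i j. D $ i $ j = (\<Sum>k<d. (y i k - y j k)\<^sup>2))"

definition nonneg_entries :: "real^'n^'n \<Rightarrow> bool" where
  "nonneg_entries D \<longleftrightarrow> (\<forall>i j. 0 \<le> D $ i $ j)"

definition elementwise_power :: "real^'n^'n \<Rightarrow> real \<Rightarrow> real^'n^'n" where
  "elementwise_power D a = (\<chi> i j. D $ i $ j powr a)"

text \<open>The elementwise power is only meaningful for nonnegative entries, whereas
  \<open>powr\<close> is total; hence the explicit nonnegativity requirement.\<close>

definition Omega :: "real \<Rightarrow> (real^'n^'n) set" where
  "Omega a = {W. weighted_graph W \<and> nonneg_entries (effective_resistance W) \<and>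
                 is_EDM (elementwise_power (effective_resistance W) a)}"

end

theory Submission
  imports Defs
begin

text \<open>On the hyperplane \<open>\<one>\<^sup>\<bottom>\<close> of vectors with vanishing coordinate sum the quadratic form of \<open>-R\<close> is
  twice that of the pseudoinverse of the Laplacian, which is positive definite there because the
  kernel of the Laplacian is spanned by \<open>\<one>\<close>. By compactness of the unit sphere the form of \<open>-R\<close> is
  bounded below by \<open>c > 0\<close> times the squared norm, and since the entries of \<open>R\<close> raised to the power
  \<open>a\<close> tend to those of \<open>R\<close> as \<open>a\<close> tends to \<open>1\<close>, the form remains nonnegative for \<open>a\<close>
  close to \<open>1\<close>. Schoenberg's criterion then yields the embedding.\<close>

section \<open>Gram factorisation of positive semidefinite forms\<close>

text \<open>For small \<open>t\<close> of sign opposite to \<open>b\<close> the linear term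
  dominates the quadratic one. The choice \<open>t = - b / m\<close> is small enough because
  \<open>c < 2 * m\<close>.\<close>

lemma linear_coeff_zero_if_quadratic_nonneg:
  fixes b c :: real
  assumes "\<And>t. 0 \<le> 2 * t * b + t\<^sup>2 * c"
  shows "b = 0"
proof (rule ccontr)
  assume "b \<noteq> 0"
  define m where "m = \<bar>c\<bar> + 1"
  have "m > 0" "c < 2 * m" by (auto simp: m_def)
  have "0 \<le> 2 * (- b / m) * b + (- b / m)\<^sup>2 * c"
    by (rule assms)
  also have "\<dots> = (b / m)\<^sup>2 * (c - 2 * m)"
    using \<open>m > 0\<close> by (simp add: field_simps power2_eq_square)
  also have "\<dots> < 0"
    using \<open>b \<noteq> 0\<close> \<open>m > 0\<close> \<open>c < 2 * m\<close> by (intro mult_pos_neg) auto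
  finally show False by simp
qed

text \<open>Cholesky factorisation: the induction step passes to the Schur complement of \<open>G s s\<close>. If
  \<open>G s s = 0\<close>, then the whole row \<open>s\<close> vanishes and the same formulas work with \<open>x / 0 = 0\<close>.\<close>

lemma psd_Gram_representation:
  fixes G :: "'a \<Rightarrow> 'a \<Rightarrow> real"
  assumes "finite S"
    and "\<And>i j. i \<in> S \<Longrightarrow> j \<in> S \<Longrightarrow> G i j = G j i"
    and "\<And>x. 0 \<le> (\<Sum>i\<in>S. \<Sum>j\<in>S. x i * x j * G i j)"
  shows "\<exists>y :: 'a \<Rightarrow> nat \<Rightarrow> real. \<forall>i\<in>S. \<forall>j\<in>S. G i j = (\<Sum>k<card S. y i k * y j k)"
  using assms
proof (induction S arbitrary: G rule: finite_induct)
  case empty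
  then show ?case by simp
next
  case (insert s S)
  have sym: "G i s = G s i" if "i \<in> S" for i
    using insert.prems(1) that by blast
  have expand: "(\<Sum>i\<in>insert s S. \<Sum>j\<in>insert s S. x i * x j * G i j) =
      (x s)\<^sup>2 * G s s + 2 * x s * (\<Sum>j\<in>S. x j * G s j) + (\<Sum>i\<in>S. \<Sum>j\<in>S. x i * x j * G i j)" for x
  proof -
    have "(\<Sum>i\<in>S. x i * x s * G i s) = x s * (\<Sum>j\<in>S. x j * G s j)"
      by (simp add: sum_distrib_left sym mult_ac)
    moreover have "(\<Sum>j\<in>S. x s * x j * G s j) = x s * (\<Sum>j\<in>S. x j * G s j)"
      by (simp add: sum_distrib_left mult_ac)
    ultimately show ?thesis
      using insert.hyps by (simp add: sum.distrib power2_eq_square algebra_simps)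
  qed
  have diag_nonneg: "0 \<le> G s s"
  proof -
    have "(\<Sum>j\<in>S. (if j = s then 1 else 0) * G s j) = 0"
      using insert.hyps by (intro sum.neutral) auto
    moreover have "(\<Sum>i\<in>S. \<Sum>j\<in>S. (if i = s then 1 else 0) * (if j = s then 1 else 0) * G i j) = 0"
      using insert.hyps by (intro sum.neutral) auto
    ultimately show ?thesis
      using insert.prems(2)[of "\<lambda>i. if i = s then 1 else 0"] unfolding expand by simp
  qed
  have row_zero: "G s j = 0" if "G s s = 0" "j \<in> S" for j
  proof (rule linear_coeff_zero_if_quadratic_nonneg[where c = "G j j"])
    fix t :: real
    \<comment> \<open>The test vector \<open>e_s + t e_j\<close> isolates the entry
      \<open>G s j\<close>: since \<open>G s s = 0\<close>, its form is a quadratic in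
      \<open>t\<close> without constant term.\<close>
    define x where "x i = (if i = s then 1 else if i = j then t else 0)" for i
    have "j \<noteq> s" using insert.hyps that by auto
    have "(\<Sum>i\<in>S. x i * G s i) = (\<Sum>i\<in>S. if i = j then t * G s i else 0)"
      using insert.hyps by (intro sum.cong) (auto simp: x_def)
    then have 1: "(\<Sum>i\<in>S. x i * G s i) = t * G s j"
      using insert.hyps that by simp
    have "(\<Sum>i\<in>S. \<Sum>l\<in>S. x i * x l * G i l) =
        (\<Sum>i\<in>S. \<Sum>l\<in>S. if l = j then (if i = j then t\<^sup>2 * G i l else 0) else 0)"
      using insert.hyps by (intro sum.cong) (auto simp: x_def power2_eq_square)
    then have 2: "(\<Sum>i\<in>S. \<Sum>l\<in>S. x i * x l * G i l) = t\<^sup>2 * G j j"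
      using insert.hyps that by simp
    show "0 \<le> 2 * t * G s j + t\<^sup>2 * G j j"
      using insert.prems(2)[of x] that unfolding expand 1 2 by (simp add: x_def)
  qed
  define G' where "G' i j = G i j - G s i * G s j / G s s" for i j
  have "\<exists>y :: 'a \<Rightarrow> nat \<Rightarrow> real. \<forall>i\<in>S. \<forall>j\<in>S. G' i j = (\<Sum>k<card S. y i k * y j k)"
  proof (rule insert.IH)
    show "G' i j = G' j i" if "i \<in> S" "j \<in> S" for i j
      using insert.prems(1) that by (simp add: G'_def mult.commute)
    show "0 \<le> (\<Sum>i\<in>S. \<Sum>j\<in>S. x i * x j * G' i j)" for x
    proof -
      define b where "b = (\<Sum>j\<in>S. x j * G s j)"
      \<comment> \<open>If \<open>G s s > 0\<close>, this value at \<open>s\<close> minimises the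
        form over the coordinate \<open>s\<close>, and the minimum is the form of the Schur
        complement. If \<open>G s s = 0\<close>, the value is \<open>0\<close> and both forms
        agree.\<close>
      define x' where "x' = x(s := - b / G s s)"
      have b': "(\<Sum>j\<in>S. x' j * G s j) = b"
        unfolding b_def using insert.hyps by (intro sum.cong) (auto simp: x'_def)
      have q': "(\<Sum>i\<in>S. \<Sum>j\<in>S. x' i * x' j * G i j) = (\<Sum>i\<in>S. \<Sum>j\<in>S. x i * x j * G i j)"
        using insert.hyps by (intro sum.cong) (auto simp: x'_def)
      have "(\<Sum>i\<in>S. \<Sum>j\<in>S. x i * x j * (G s i * G s j / G s s)) = b * b / G s s"
        unfolding b_def sum_product sum_divide_distrib
        by (intro sum.cong) (auto simp: mult_ac)
      then have "(\<Sum>i\<in>S. \<Sum>j\<in>S. x i * x j * G' i j) =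
          (\<Sum>i\<in>S. \<Sum>j\<in>S. x i * x j * G i j) - b * b / G s s"
        by (simp add: G'_def right_diff_distrib sum_subtractf)
      also have "\<dots> = (\<Sum>i\<in>insert s S. \<Sum>j\<in>insert s S. x' i * x' j * G i j)"
        unfolding expand b' q' by (cases "G s s = 0") (auto simp: x'_def power2_eq_square field_simps)
      finally show ?thesis using insert.prems(2)[of x'] by simp
    qed
  qed
  then obtain y :: "'a \<Rightarrow> nat \<Rightarrow> real"
    where y: "\<And>i j. i \<in> S \<Longrightarrow> j \<in> S \<Longrightarrow> G' i j = (\<Sum>k<card S. y i k * y j k)"
    by blast
  \<comment> \<open>Index \<open>card S\<close> is the fresh coordinate and holds the Cholesky
    column of \<open>s\<close>. The values of \<open>y\<close> at \<open>s\<close> are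
    unconstrained, so they are overwritten by \<open>0\<close>.\<close>
  define z where "z i k = (if k = card S then G s i / sqrt (G s s) else if i = s then 0 else y i k)"
    for i k
  have "G i j = (\<Sum>k<card (insert s S). z i k * z j k)"
    if ij: "i \<in> insert s S" "j \<in> insert s S" for i j
  proof -
    have "(\<Sum>k<card (insert s S). z i k * z j k) =
        (\<Sum>k<card S. z i k * z j k) + G s i * G s j / G s s"
      using insert.hyps diag_nonneg by (simp add: z_def real_sqrt_mult_self)
    also have "(\<Sum>k<card S. z i k * z j k) = (if i = s \<or> j = s then 0 else G' i j)"
      using that y[of i j] by (auto simp: z_def)
    also have "\<dots> + G s i * G s j / G s s = G i j"
    proof -
      consider "i = s" | "i \<noteq> s" "j = s" | "i \<in> S" "j \<in> S" "i \<noteq> s" "j \<noteq> s"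
        using ij by blast
      then show ?thesis
      proof cases
        case 1
        then show ?thesis
          using ij row_zero[of j] by (cases "G s s = 0") auto
      next
        case 2
        then show ?thesis
          using ij row_zero[of i] sym[of i] by (cases "G s s = 0") auto
      next
        case 3
        then show ?thesis by (simp add: G'_def)
      qed
    qed
    finally show ?thesis by simp
  qed
  then show ?case by blast
qed

section \<open>Schoenberg's criterion for Euclidean distance matrices\<close>

lemma inner_matrix_vector_mult:
  fixes A :: "real^'n^'m"
  shows "x \<bullet> (A *v y) = (\<Sum>i\<in>UNIV. \<Sum>j\<in>UNIV. x $ i * y $ j * A $ i $ j)"
  by (simp add: inner_vec_def matrix_vector_mult_def sum_distrib_left mult_ac)

text \<open>One node \<open>o'\<close> is placed at the origin. By polarisation, \<open>G\<close> is
  then the Gram matrix the other points must have, and factoring it over these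
  \<open>CARD('n) - 1\<close> nodes gives the required bound on the dimension.\<close>

lemma Schoenberg_is_EDM:
  fixes D :: "real^'n^'n"
  assumes sym: "\<And>i j. D $ i $ j = D $ j $ i"
    and diag: "\<And>i. D $ i $ i = 0"
    and cond: "\<And>x. (\<Sum>i\<in>UNIV. x $ i) = 0 \<Longrightarrow> x \<bullet> (D *v x) \<le> 0"
  shows "is_EDM D"
proof -
  obtain o' :: 'n where True by simp
  define S where "S = UNIV - {o'}"
  define G where "G i j = (D $ i $ o' + D $ j $ o' - D $ i $ j) / 2" for i j
  have UNIV_eq: "UNIV = insert o' S" and [simp]: "o' \<notin> S" "finite S"
    by (auto simp: S_def)
  have card_S: "card S = CARD('n) - 1"
    by (simp add: S_def)
  have "\<exists>y :: 'n \<Rightarrow> nat \<Rightarrow> real. \<forall>i\<in>S. \<forall>j\<in>S. G i j = (\<Sum>k<card S. y i k * y j k)"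
  proof (rule psd_Gram_representation)
    show "G i j = G j i" for i j
      by (simp add: G_def sym[of i j])
    show "0 \<le> (\<Sum>i\<in>S. \<Sum>j\<in>S. x i * x j * G i j)" for x
    proof -
      define t where "t = (\<Sum>i\<in>S. x i)"
      define d where "d = (\<Sum>i\<in>S. x i * D $ i $ o')"
      define q where "q = (\<Sum>i\<in>S. \<Sum>j\<in>S. x i * x j * D $ i $ j)"
      \<comment> \<open>The entry \<open>- t\<close> at \<open>o'\<close> moves \<open>x\<close>
        into the hyperplane of sum zero, where the form of \<open>D\<close> is \<open>-2\<close>
        times the Gram form of \<open>x\<close>.\<close>
      define v :: "real^'n" where "v = (\<chi> i. if i = o' then - t else x i)"
      have v_o: "v $ o' = - t"
        by (simp add: v_def)
      have v_S: "v $ i = x i" if "i \<in> S" for i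
        using that by (auto simp: v_def S_def)
      have "(\<Sum>i\<in>UNIV. v $ i) = 0"
        unfolding UNIV_eq by (simp add: v_o v_S t_def)
      then have "v \<bullet> (D *v v) \<le> 0"
        by (rule cond)
      also have "v \<bullet> (D *v v) = q - 2 * t * d"
      proof -
        have "(\<Sum>j\<in>S. t * x j * D $ o' $ j) = t * d"
          by (simp add: d_def sum_distrib_left sym[of o'] mult_ac)
        moreover have "(\<Sum>i\<in>S. x i * t * D $ i $ o') = t * d"
          by (simp add: d_def sum_distrib_left mult_ac)
        ultimately show ?thesis
          unfolding inner_matrix_vector_mult UNIV_eq
          by (simp add: v_o v_S diag q_def sum_negf sum_subtractf)
      qed
      finally have "0 \<le> t * d - q / 2" by simp
      also have "t * d - q / 2 = (\<Sum>i\<in>S. \<Sum>j\<in>S. x i * x j * G i j)"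
      proof -
        have "(\<Sum>i\<in>S. \<Sum>j\<in>S. x i * x j * D $ j $ o') = t * d"
          unfolding t_def d_def sum_product by (simp add: mult_ac)
        moreover have "(\<Sum>i\<in>S. \<Sum>j\<in>S. x i * x j * D $ i $ o') = d * t"
          unfolding t_def d_def sum_product by (simp add: mult_ac)
        moreover have "x i * x j * G i j = x i * x j * D $ i $ o' / 2
            + x i * x j * D $ j $ o' / 2 - x i * x j * D $ i $ j / 2" for i j
          by (simp add: G_def field_simps)
        ultimately show ?thesis
          by (simp add: q_def sum.distrib sum_subtractf flip: sum_divide_distrib)
      qed
      finally show ?thesis .
    qed
  qed simp
  then obtain y :: "'n \<Rightarrow> nat \<Rightarrow> real"
    where y: "\<And>i j. i \<in> S \<Longrightarrow> j \<in> S \<Longrightarrow> G i j = (\<Sum>k<card S. y i k * y j k)"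
    by blast
  define z where "z i k = (if i = o' then 0 else y i k)" for i k
  have Gz: "G i j = (\<Sum>k<card S. z i k * z j k)" for i j
  proof (cases "i = o' \<or> j = o'")
    case True
    then show ?thesis
      by (auto simp: z_def G_def diag sym[of o'])
  next
    case False
    then have "i \<in> S" "j \<in> S"
      by (auto simp: S_def)
    from y[OF this] show ?thesis
      using False by (simp add: z_def)
  qed
  have "D $ i $ j = (\<Sum>k<card S. (z i k - z j k)\<^sup>2)" for i j
  proof -
    have "D $ i $ j = G i i + G j j - 2 * G i j"
      by (simp add: G_def diag field_simps)
    also have "\<dots> = (\<Sum>k<card S. (z i k - z j k)\<^sup>2)"
      unfolding Gz sum_distrib_left sum.distrib[symmetric] sum_subtractf[symmetric]
      by (intro sum.cong) (auto simp: power2_eq_square algebra_simps)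
    finally show ?thesis .
  qed
  then show ?thesis
    unfolding is_EDM_def card_S by blast
qed

section \<open>Kernels of positive semidefinite matrices and of the Laplacian\<close>

text \<open>The form attains its minimum \<open>0\<close> at \<open>x\<close>, so its derivative at
  \<open>x\<close> in the direction \<open>A *v x\<close>, which is twice the squared norm of
  \<open>A *v x\<close>, must vanish.\<close>

lemma psd_kernel:
  fixes A :: "real^'n^'n"
  assumes psd: "positive_semidefinite A" and "x \<bullet> (A *v x) = 0"
  shows "A *v x = 0"
proof -
  let ?y = "A *v x"
  have sym: "x \<bullet> (A *v ?y) = ?y \<bullet> ?y"
    using psd by (metis positive_semidefinite_def dot_lmul_matrix vector_transpose_matrix)
  have "?y \<bullet> ?y = 0"
  proof (rule linear_coeff_zero_if_quadratic_nonneg)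
    fix t :: real
    have "0 \<le> (x + t *\<^sub>R ?y) \<bullet> (A *v (x + t *\<^sub>R ?y))"
      using psd by (simp add: positive_semidefinite_def)
    also have "\<dots> = 2 * t * (?y \<bullet> ?y) + t\<^sup>2 * (?y \<bullet> (A *v ?y))"
      using assms(2) sym
      by (simp add: matrix_vector_right_distrib matrix_vector_mult_scaleR inner_add_left
          inner_add_right power2_eq_square algebra_simps)
    finally show "0 \<le> 2 * t * (?y \<bullet> ?y) + t\<^sup>2 * (?y \<bullet> (A *v ?y))" .
  qed
  then show ?thesis by simp
qed

lemma inner_one_vec: "x \<bullet> (1 :: real^'n) = (\<Sum>i\<in>UNIV. x $ i)"
  by (simp add: inner_vec_def)

lemma laplacian_mult_one: "weighted_graph W \<Longrightarrow> laplacian W *v 1 = 0"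
proof -
  assume graph: "weighted_graph W"
  have "(\<Sum>j\<in>UNIV. if i = j then \<Sum>k\<in>UNIV. W $ i $ k else - W $ i $ j) = 0" for i
  proof -
    have "(\<Sum>j\<in>UNIV. if i = j then \<Sum>k\<in>UNIV. W $ i $ k else - W $ i $ j) =
        (\<Sum>j\<in>UNIV. (if i = j then \<Sum>k\<in>UNIV. W $ i $ k else 0) - W $ i $ j)"
      using graph by (intro sum.cong) (auto simp: weighted_graph_def)
    then show ?thesis
      by (simp add: sum_subtractf)
  qed
  then show ?thesis
    by (simp add: vec_eq_iff laplacian_def matrix_vector_mult_def)
qed

text \<open>The kernel of a symmetric matrix is orthogonal to its range. A nonzero \<open>x\<close>
  would, together with \<open>u\<close>, add two dimensions to a range of dimension
  \<open>CARD('n) - 1\<close>, which exceeds the whole space.\<close>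

lemma kernel_corank_one:
  fixes A :: "real^'n^'n"
  assumes sym: "transpose A = A" and rank: "rank A = CARD('n) - 1"
    and u: "A *v u = 0" "u \<noteq> 0" and x: "A *v x = 0" "x \<bullet> u = 0"
  shows "x = 0"
proof (rule ccontr)
  assume "x \<noteq> 0"
  have "y \<bullet> z = 0" if "y \<in> range ((*v) A)" "z \<in> {u, x}" for y z
  proof -
    obtain w where "y = A *v w" using \<open>y \<in> _\<close> by blast
    then have "y \<bullet> z = w \<bullet> (A *v z)"
      by (metis dot_lmul_matrix sym vector_transpose_matrix)
    then show ?thesis using that u x by auto
  qed
  then have "dim (range ((*v) A) \<union> {u, x}) = dim (range ((*v) A)) + dim {u, x}"
    by (rule dim_orthogonal_sum)
  moreover have "dim (range ((*v) A) \<union> {u, x}) \<le> CARD('n)"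
    using dim_subset_UNIV[of "range ((*v) A) \<union> {u, x}"] by simp
  moreover have "dim {u, x} = 2"
  proof -
    have "u \<noteq> x" using x(2) u(2) by auto
    have "independent {u, x}"
      using \<open>x \<noteq> 0\<close> u(2) x(2)
      by (intro pairwise_orthogonal_independent)
        (auto simp: pairwise_def orthogonal_def inner_commute)
    then show ?thesis
      using \<open>u \<noteq> x\<close> by (simp add: dim_eq_card_independent)
  qed
  moreover have "CARD('n) > 0" by simp
  ultimately show False
    using rank by (simp add: rank_dim_range)
qed

section \<open>The pseudoinverse of the Laplacian\<close>

lemma transpose_add: "transpose (A + B) = transpose A + transpose B"
  by (simp add: transpose_def vec_eq_iff)

lemma transpose_diff: "transpose (A - B) = transpose A - transpose B"
  by (simp add: transpose_def vec_eq_iff)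

lemma matrix_add_rdistrib:
  fixes A :: "real^'n^'m"
  shows "(A + B) ** C = A ** C + B ** C"
  by (simp add: matrix_matrix_mult_def vec_eq_iff distrib_right sum.distrib)

lemma matrix_diff_ldistrib:
  fixes A :: "real^'n^'m"
  shows "A ** (B - C) = A ** B - A ** C"
  by (simp add: matrix_matrix_mult_def vec_eq_iff right_diff_distrib sum_subtractf)

lemma matrix_diff_rdistrib:
  fixes A :: "real^'n^'m"
  shows "(A - B) ** C = A ** C - B ** C"
  by (simp add: matrix_matrix_mult_def vec_eq_iff left_diff_distrib sum_subtractf)

text \<open>The pseudoinverse is \<open>(L + J)\<^sup>-\<^sup>1 - J / p\<^sup>2\<close>, where \<open>J\<close> is the all-ones matrix.\<close>

lemma is_pseudoinverse_laplacian:
  fixes W :: "real^'n^'n"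
  defines "L \<equiv> laplacian W"
  assumes graph: "weighted_graph W" and psd: "positive_semidefinite L"
    and rank: "rank L = CARD('n) - 1"
  obtains P where "is_pseudoinverse L P" "transpose P = P"
    "L ** P = mat 1 - (1 / real CARD('n)) *\<^sub>R (\<chi> i j. 1)"
proof -
  define p where "p = real CARD('n)"
  define J :: "real^'n^'n" where "J = (\<chi> i j. 1)"
  have p: "p > 0" by (simp add: p_def)
  have symL: "transpose L = L"
    using psd by (simp add: positive_semidefinite_def)
  have symJ: "transpose J = J"
    by (simp add: J_def transpose_def)
  have L1: "L *v 1 = 0"
    using graph by (simp add: L_def laplacian_mult_one)
  have LJ: "L ** J = 0"
    using L1 by (simp add: J_def vec_eq_iff matrix_matrix_mult_def matrix_vector_mult_def)
  have JL: "J ** L = 0"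
    using arg_cong[OF LJ, of transpose]
    by (simp add: matrix_transpose_mul symJ symL) (simp add: transpose_def vec_eq_iff)
  have JJ: "J ** J = p *\<^sub>R J"
    by (simp add: J_def p_def vec_eq_iff matrix_matrix_mult_def)
  have Jx: "J *v x = (x \<bullet> 1) *\<^sub>R 1" for x
    by (simp add: J_def vec_eq_iff matrix_vector_mult_def inner_one_vec)
  have "x = 0" if "(L + J) *v x = 0" for x
  proof -
    \<comment> \<open>Pairing with \<open>x\<close> splits the equation into two nonnegative terms,
      so both vanish: \<open>x\<close> lies in the kernel of \<open>L\<close> and is orthogonal to
      its kernel vector \<open>1\<close>.\<close>
    have "x \<bullet> (L *v x) + (x \<bullet> 1)\<^sup>2 = 0"
      using arg_cong[OF that, of "\<lambda>y. x \<bullet> y"]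
      by (simp add: matrix_vector_mult_add_rdistrib inner_add_right Jx power2_eq_square)
    moreover have "0 \<le> x \<bullet> (L *v x)"
      using psd by (simp add: positive_semidefinite_def)
    ultimately have "x \<bullet> (L *v x) = 0" "x \<bullet> 1 = 0"
      by (auto simp: add_nonneg_eq_0_iff)
    then show ?thesis
      using kernel_corank_one[OF symL rank L1 _ psd_kernel[OF psd]] by simp
  qed
  then have "inj ((*v) (L + J))"
    by (metis matrix_left_invertible_injective matrix_left_invertible_ker)
  then obtain N where NM: "N ** (L + J) = mat 1"
    using matrix_left_invertible_injective by blast
  then have MN: "(L + J) ** N = mat 1"
    by (simp add: matrix_left_right_inverse)
  have symN: "transpose N = N"
  proof -
    have "(L + J) ** transpose N = mat 1"
      using NM by (metis matrix_transpose_mul symJ symL transpose_mat transpose_add)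
    then show ?thesis
      using NM by (metis matrix_mul_assoc matrix_mul_lid matrix_mul_rid)
  qed
  have MJ: "(L + J) ** J = p *\<^sub>R J"
    by (simp add: matrix_add_rdistrib LJ JJ)
  have NJ: "N ** J = (1 / p) *\<^sub>R J"
  proof -
    have "p *\<^sub>R (N ** J) = N ** ((L + J) ** J)"
      by (simp add: MJ matrix_scalar_ac flip: scalar_matrix_assoc)
    also have "\<dots> = J"
      by (simp add: matrix_mul_assoc NM)
    finally have "(1 / p) *\<^sub>R J = (1 / p) *\<^sub>R p *\<^sub>R (N ** J)"
      by simp
    then show ?thesis using p by simp
  qed
  have JN: "J ** N = (1 / p) *\<^sub>R J"
    using NJ by (metis matrix_transpose_mul symJ symN transpose_scalar)
  \<comment> \<open>\<open>N\<close> acts on the vector \<open>1\<close> as multiplication by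
    \<open>1 / p\<close>, and \<open>J / p\<close> is the orthogonal projection onto its span.
    Subtracting their product removes exactly this component.\<close>
  define P where "P = N - (1 / p\<^sup>2) *\<^sub>R J"
  have symP: "transpose P = P"
    by (simp add: P_def symN symJ transpose_diff transpose_scalar)
  have JP: "J ** P = 0"
    using p
      by (simp add: P_def matrix_diff_ldistrib JN JJ matrix_scalar_ac power2_eq_square
          flip: scalar_matrix_assoc)
  have LP: "L ** P = mat 1 - (1 / p) *\<^sub>R J"
  proof -
    have "L ** P = L ** N"
      by (simp add: P_def matrix_diff_ldistrib LJ matrix_scalar_ac flip: scalar_matrix_assoc)
    then show ?thesis
      using MN by (simp add: matrix_add_rdistrib JN algebra_simps)
  qed
  have PL: "P ** L = mat 1 - (1 / p) *\<^sub>R J"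
    using LP by (metis matrix_transpose_mul symP symL symJ transpose_diff transpose_mat transpose_scalar)
  have "L ** P ** L = L"
    by (simp add: LP matrix_diff_rdistrib JL flip: scalar_matrix_assoc)
  moreover have "P ** L ** P = P"
    by (simp add: PL matrix_diff_rdistrib JP flip: scalar_matrix_assoc)
  ultimately have "is_pseudoinverse L P"
    by (simp add: is_pseudoinverse_def LP PL transpose_diff transpose_scalar symJ)
  then show thesis
    using that symP LP by (simp add: p_def J_def)
qed

lemma pseudoinverse_eqI: "is_pseudoinverse A X \<Longrightarrow> pseudoinverse A = X"
  unfolding pseudoinverse_def by (blast intro: is_pseudoinverse_unique)

text \<open>The two diagonal terms give rank-one matrices with a factor \<open>1\<close>, which
  \<open>x\<close> annihilates.\<close>

lemma distance_form_sum_zero: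
  fixes P :: "real^'n^'n"
  assumes "(\<Sum>i\<in>UNIV. x $ i) = 0"
  shows "x \<bullet> ((\<chi> i j. P $ i $ i + P $ j $ j - 2 * P $ i $ j) *v x) = - 2 * (x \<bullet> (P *v x))"
proof -
  have "x \<bullet> ((\<chi> i j. P $ i $ i + P $ j $ j - 2 * P $ i $ j) *v x) =
      (\<Sum>i\<in>UNIV. x $ i * P $ i $ i) * (\<Sum>j\<in>UNIV. x $ j)
      + (\<Sum>i\<in>UNIV. x $ i) * (\<Sum>j\<in>UNIV. x $ j * P $ j $ j) - 2 * (x \<bullet> (P *v x))"
    unfolding inner_matrix_vector_mult sum_product
    by (simp add: sum_distrib_left sum.distrib sum_subtractf algebra_simps)
  then show ?thesis using assms by simp
qed

text \<open>\<open>L ** P\<close> is the orthogonal projection onto the hyperplane, so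
  \<open>L *v (P *v x) = x\<close>. The form of \<open>P\<close> at \<open>x\<close> is thus the
  form of \<open>L\<close> at \<open>P *v x\<close>, and its vanishing would force
  \<open>x = 0\<close>.\<close>

lemma pseudoinverse_laplacian_pos:
  fixes W :: "real^'n^'n"
  defines "L \<equiv> laplacian W"
  assumes graph: "weighted_graph W" and psd: "positive_semidefinite L"
    and rank: "rank L = CARD('n) - 1"
    and x: "(\<Sum>i\<in>UNIV. x $ i) = 0" "x \<noteq> 0"
  shows "0 < x \<bullet> (pseudoinverse L *v x)"
proof -
  obtain P where P: "is_pseudoinverse L P" "transpose P = P"
    "L ** P = mat 1 - (1 / real CARD('n)) *\<^sub>R (\<chi> i j. 1)"
    using is_pseudoinverse_laplacian graph psd rank unfolding L_def by blast
  have "(\<chi> i j. 1) *v x = 0"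
    using x(1) by (simp add: vec_eq_iff matrix_vector_mult_def)
  then have LPx: "L *v (P *v x) = x"
    by (simp add: matrix_vector_mul_assoc P(3) matrix_vector_mult_diff_rdistrib
        flip: scaleR_matrix_vector_assoc)
  have eq: "x \<bullet> (P *v x) = (P *v x) \<bullet> (L *v (P *v x))"
    by (simp add: LPx inner_commute)
  have "0 \<le> x \<bullet> (P *v x)"
    unfolding eq using psd by (simp add: positive_semidefinite_def)
  moreover have "x \<bullet> (P *v x) \<noteq> 0"
    using psd_kernel[OF psd, of "P *v x"] x(2) LPx by (auto simp: eq)
  ultimately show ?thesis
    using pseudoinverse_eqI[OF P(1)] by simp
qed

lemma pseudoinverse_laplacian_symmetric:
  fixes W :: "real^'n^'n"
  assumes "weighted_graph W" "positive_semidefinite (laplacian W)"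
    "rank (laplacian W) = CARD('n) - 1"
  shows "transpose (pseudoinverse (laplacian W)) = pseudoinverse (laplacian W)"
  using is_pseudoinverse_laplacian[OF assms] pseudoinverse_eqI by metis

section \<open>Coercivity and perturbation of quadratic forms\<close>

lemma quadratic_form_coercive:
  fixes A :: "real^'n^'n"
  assumes "subspace V" and pos: "\<And>x. x \<in> V \<Longrightarrow> x \<noteq> 0 \<Longrightarrow> 0 < x \<bullet> (A *v x)"
  obtains c where "c > 0" "\<And>x. x \<in> V \<Longrightarrow> c * (norm x)\<^sup>2 \<le> x \<bullet> (A *v x)"
proof (cases "sphere 0 1 \<inter> V = {}")
  \<comment> \<open>Here \<open>V\<close> is the zero space, as happens for a graph with a single
    node, and any positive constant works.\<close>
  case True
  have "x = 0" if "x \<in> V" for x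
  proof (rule ccontr)
    assume "x \<noteq> 0"
    then have "x /\<^sub>R norm x \<in> sphere 0 1 \<inter> V"
      using that \<open>subspace V\<close> by (simp add: subspace_scale)
    then show False using True by blast
  qed
  then show thesis using that[of 1] by fastforce
next
  case False
  have "compact (sphere 0 1 \<inter> V)"
    using \<open>subspace V\<close> by (intro compact_Int_closed closed_subspace) auto
  moreover have "continuous_on (sphere 0 1 \<inter> V) (\<lambda>x. x \<bullet> (A *v x))"
    by (intro continuous_intros linear_continuous_on matrix_vector_mul_bounded_linear)
  ultimately obtain z where z: "z \<in> sphere 0 1 \<inter> V"
    "\<And>x. x \<in> sphere 0 1 \<inter> V \<Longrightarrow> z \<bullet> (A *v z) \<le> x \<bullet> (A *v x)"
    using continuous_attains_inf[OF _ False] by blast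
  show thesis
  proof
    show "0 < z \<bullet> (A *v z)" using z(1) by (intro pos) auto
    show "z \<bullet> (A *v z) * (norm x)\<^sup>2 \<le> x \<bullet> (A *v x)" if "x \<in> V" for x
    proof (cases "x = 0")
      case False
      have "x /\<^sub>R norm x \<in> sphere 0 1 \<inter> V"
        using False that \<open>subspace V\<close> by (simp add: subspace_scale)
      from z(2)[OF this] have "z \<bullet> (A *v z) \<le> (x \<bullet> (A *v x)) / (norm x)\<^sup>2"
        by (simp add: matrix_vector_mult_scaleR power2_eq_square field_simps)
      then show ?thesis using False by (simp add: field_simps)
    qed simp
  qed
qed

text \<open>This crude bound turns entrywise convergence of matrices into a bound on their forms
  that is uniform in \<open>x\<close>.\<close>

lemma quadratic_form_le_sum_abs:
  fixes A :: "real^'n^'n"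
  shows "x \<bullet> (A *v x) \<le> (\<Sum>i\<in>UNIV. \<Sum>j\<in>UNIV. \<bar>A $ i $ j\<bar>) * (norm x)\<^sup>2"
proof -
  have "x $ i * x $ j * A $ i $ j \<le> \<bar>A $ i $ j\<bar> * (norm x)\<^sup>2" for i j
  proof -
    have "x $ i * x $ j * A $ i $ j \<le> \<bar>A $ i $ j\<bar> * (\<bar>x $ i\<bar> * \<bar>x $ j\<bar>)"
      by (metis abs_ge_self abs_mult mult.commute)
    also have "\<dots> \<le> \<bar>A $ i $ j\<bar> * (norm x)\<^sup>2"
      unfolding power2_eq_square
      by (intro mult_left_mono mult_mono component_le_norm_cart) auto
    finally show ?thesis .
  qed
  then show ?thesis
    unfolding inner_matrix_vector_mult sum_distrib_right by (intro sum_mono)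
qed

lemma elementwise_power_tendsto:
  assumes "nonneg_entries D"
  shows "((\<lambda>a. \<Sum>i\<in>UNIV. \<Sum>j\<in>UNIV. \<bar>(elementwise_power D a - D) $ i $ j\<bar>) \<longlongrightarrow> 0) (at 1)"
proof -
  have "((\<lambda>a. D $ i $ j powr a) \<longlongrightarrow> D $ i $ j) (at 1)" for i j
  \<comment> \<open>Continuity of \<open>powr\<close> in the exponent is applied at nonzero bases;
    for a zero entry the power is constantly \<open>0\<close>.\<close>
  proof (cases "D $ i $ j = 0")
    case False
    then have "((\<lambda>a. D $ i $ j powr a) \<longlongrightarrow> D $ i $ j powr 1) (at 1)"
      by (intro tendsto_intros) auto
    then show ?thesis
      using assms by (simp add: nonneg_entries_def)
  qed simp
  then have "((\<lambda>a. \<bar>(elementwise_power D a - D) $ i $ j\<bar>) \<longlongrightarrow> 0) (at 1)" for i j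
    by (intro tendsto_rabs_zero) (simp add: elementwise_power_def LIM_zero)
  then show ?thesis
    by (intro tendsto_null_sum)
qed

theorem proposition2:
  fixes W :: "real^'n^'n"
  assumes "weighted_graph W"
    and "graph_connected W"
    and "positive_semidefinite (laplacian W)"
    and "rank (laplacian W) = CARD('n) - 1"
  shows "\<exists>\<gamma>>1. \<forall>a\<in>{1..\<gamma>}. W \<in> Omega a"
proof -
  define P where "P = pseudoinverse (laplacian W)"
  define R where "R = effective_resistance W"
  define V :: "(real^'n) set" where "V = {x. (\<Sum>i\<in>UNIV. x $ i) = 0}"
  have R_eq: "R = (\<chi> i j. P $ i $ i + P $ j $ j - 2 * P $ i $ j)"
    by (simp add: R_def P_def effective_resistance_def Let_def)
  have symP: "P $ i $ j = P $ j $ i" for i j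
    using pseudoinverse_laplacian_symmetric[OF assms(1,3,4)]
    by (metis P_def transpose_def vec_lambda_beta)
  have posP: "0 < x \<bullet> (P *v x)" if "x \<in> V" "x \<noteq> 0" for x
    using pseudoinverse_laplacian_pos[OF assms(1,3,4)] that by (simp add: P_def V_def)
  have V: "subspace V"
    by (simp add: V_def subspace_def sum.distrib flip: sum_distrib_left)
  obtain c where c: "c > 0" "\<And>x. x \<in> V \<Longrightarrow> c * (norm x)\<^sup>2 \<le> x \<bullet> (P *v x)"
    using quadratic_form_coercive[OF V posP] by blast
  have nonneg: "nonneg_entries R"
    unfolding nonneg_entries_def
  proof (intro allI)
    fix i j
    \<comment> \<open>The form of \<open>P\<close> at this difference of basis vectors is the
      effective resistance between \<open>i\<close> and \<open>j\<close>.\<close>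
    let ?x = "axis i 1 - axis j 1 :: real^'n"
    have "?x \<in> V"
      by (simp add: V_def sum_subtractf axis_def)
    then have "0 \<le> ?x \<bullet> (P *v ?x)"
      by (metis posP inner_zero_left order.order_iff_strict)
    also have "\<dots> = R $ i $ j"
      by (simp add: R_eq matrix_vector_mult_diff_distrib inner_diff_left inner_diff_right
          inner_axis' matrix_vector_mult_basis column_def symP[of j i])
    finally show "0 \<le> R $ i $ j" .
  qed
  obtain \<delta> where \<delta>: "\<delta> > 0" "\<And>a. a \<noteq> 1 \<Longrightarrow> \<bar>a - 1\<bar> < \<delta> \<Longrightarrow>
      (\<Sum>i\<in>UNIV. \<Sum>j\<in>UNIV. \<bar>(elementwise_power R a - R) $ i $ j\<bar>) < c"
    using order_tendstoD(2)[OF elementwise_power_tendsto[OF nonneg] c(1)]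
    unfolding eventually_at dist_real_def by blast
  \<comment> \<open>Halving \<open>\<delta>\<close> keeps the closed interval inside the open
    neighbourhood supplied by the limit.\<close>
  have "W \<in> Omega a" if a: "a \<in> {1..1 + \<delta> / 2}" for a
  proof -
    let ?D = "elementwise_power R a"
    have "(\<Sum>i\<in>UNIV. \<Sum>j\<in>UNIV. \<bar>(?D - R) $ i $ j\<bar>) \<le> c"
    \<comment> \<open>The limit is punctured and says nothing at \<open>a = 1\<close>, but there the
      deviation is zero.\<close>
    proof (cases "a = 1")
      case True
      then show ?thesis
        using nonneg c(1) by (simp add: elementwise_power_def nonneg_entries_def)
    next
      case False
      then show ?thesis using \<delta>(2)[of a] a \<delta>(1) by auto
    qed
    then have "x \<bullet> ((?D - R) *v x) \<le> c * (norm x)\<^sup>2" for x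
      using quadratic_form_le_sum_abs[of x "?D - R"]
      by (meson mult_right_mono order_trans zero_le_power2)
    \<comment> \<open>The form of \<open>R\<close> lies below \<open>-2 * c\<close> times the
      squared norm, so a perturbation of at most \<open>c\<close> times the squared norm cannot make
      it positive.\<close>
    moreover have "x \<bullet> (R *v x) \<le> - 2 * (c * (norm x)\<^sup>2)" if "x \<in> V" for x
      using c(2)[OF that] that by (simp add: R_eq V_def distance_form_sum_zero)
    moreover have "0 \<le> c * (norm x)\<^sup>2" for x :: "real^'n"
      using c(1) by simp
    ultimately have "x \<bullet> (?D *v x) \<le> 0" if "x \<in> V" for x
      using that by (smt (verit) inner_diff_right matrix_vector_mult_diff_rdistrib)
    then have "is_EDM ?D"
      by (intro Schoenberg_is_EDM)
        (auto simp: elementwise_power_def R_eq V_def symP add.commute)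
    then show ?thesis
      using assms(1) nonneg by (simp add: Omega_def R_def)
  qed
  then show ?thesis
    using \<delta>(1) by (intro exI[of _ "1 + \<delta> / 2"]) auto
qed

end
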